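(* Let $c>0$ and $k\in(0,c/4)$, let $u_0=u_0(\cdot;k,c)$ be the smooth solitary wave profile of the Degasperis–Procesi equation with speed $c$ and asymptotic end state $k$, and set $m=u_0-u_0''$. Let $\sigma\in\mathbb C\setminus\{0\}$ and suppose that $\phi=\phi(\xi,t)$ satisfies the Lax pair $$\phi_{\xi\xi\xi}=\phi_\xi+\sigma m\phi,\qquad \phi_t=\tfrac1\sigma\phi_{\xi\xi}+(c-u_0)\phi_\xi+u_0'\phi,$$ and that $\psi=\psi(\xi,t)$ satisfies the adjoint Lax pair $$\psi_{\xi\xi\xi}=\psi_\xi-\sigma m\psi,\qquad \psi_t=-\tfrac1\sigma\psi_{\xi\xi}+(c-u_0)\psi_\xi+u_0'\psi.$$ Then the function $$v=\left(\phi\psi-\phi_\xi\psi_\xi\right)_\xi$$ solves the linearized Degasperis–Procesi equation $$v_t-v_{t\xi\xi}=c(v-v_{\xi\xi})_\xi+3u_0'v_{\xi\xi}+3u_0''v_\xi-4u_0v_\xi-4u_0'v+u_0v_{\xi\xi\xi}+u_0'''v .$$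
   Context: The Degasperis–Procesi (DP) equation is $u_t-u_{txx}=3u_xu_{xx}-4uu_x+uu_{xxx}$. For each $c>0$ and $k\in(0,c/4)$ it is known that there is a smooth traveling wave $u(x,t)=u_0(x-ct)$, with non-constant even profile $u_0=u_0(\cdot;k,c)\in C^\infty(\mathbb R)$ satisfying $(c-u_0)^3(u_0-u_0'')=k(c-k)^3$, $u_0'(0)=0$, $u_0(\xi)\to k$ as $|\xi|\to\infty$, $0<u_0<c$ and $u_0-u_0''>0$ on $\mathbb R$. Here $\xi=x-ct$ is the moving coordinate, primes on $u_0$ are derivatives in $\xi$, and $\phi,\psi$ are smooth complex-valued functions on $\mathbb R\times\mathbb R$. The displayed linearized equation is the one abbreviated in the paper as $v_t=\mathcal A[u_0]v$. *)

theory Defs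
  imports "HOL-Analysis.Analysis"
begin

text \<open>
  Functions on the plane are curried, \<open>f \<xi> t\<close>: the first argument is the space variable,
  the second one is time.
\<close>

definition ds :: "(real \<Rightarrow> real \<Rightarrow> 'a::real_normed_vector) \<Rightarrow> real \<Rightarrow> real \<Rightarrow> 'a" where
  "ds f = (\<lambda>x t. vector_derivative (\<lambda>y. f y t) (at x))"

definition dt :: "(real \<Rightarrow> real \<Rightarrow> 'a::real_normed_vector) \<Rightarrow> real \<Rightarrow> real \<Rightarrow> 'a" where
  "dt f = (\<lambda>x t. vector_derivative (\<lambda>s. f x s) (at t))"

text \<open>
  Class \<open>C\<^sup>n\<close> on the plane: all iterated partial derivatives up to order \<open>n\<close> (in any order of
  differentiation) exist and are jointly continuous.
\<close>

primrec Cn_plane :: "nat \<Rightarrow> (real \<Rightarrow> real \<Rightarrow> 'a::real_normed_vector) \<Rightarrow> bool" where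
  "Cn_plane 0 f \<longleftrightarrow> continuous_on UNIV (\<lambda>(x, t). f x t)"
| "Cn_plane (Suc n) f \<longleftrightarrow>
     continuous_on UNIV (\<lambda>(x, t). f x t) \<and>
     (\<forall>x t. (\<lambda>y. f y t) differentiable (at x)) \<and>
     (\<forall>x t. (\<lambda>s. f x s) differentiable (at t)) \<and>
     Cn_plane n (ds f) \<and> Cn_plane n (dt f)"

definition smooth_plane :: "(real \<Rightarrow> real \<Rightarrow> 'a::real_normed_vector) \<Rightarrow> bool" where
  "smooth_plane f \<longleftrightarrow> (\<forall>n. Cn_plane n f)"

definition smooth_line :: "(real \<Rightarrow> real) \<Rightarrow> bool" where
  "smooth_line f \<longleftrightarrow> (\<forall>n x. (deriv ^^ n) f differentiable (at x))"

definition DP_solution :: "(real \<Rightarrow> real \<Rightarrow> real) \<Rightarrow> bool" where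
  "DP_solution u \<longleftrightarrow> smooth_plane u \<and>
     (\<forall>x t. dt u x t - ds (ds (dt u)) x t =
        3 * ds u x t * ds (ds u) x t - 4 * u x t * ds u x t + u x t * ds (ds (ds u)) x t)"

definition momentum :: "(real \<Rightarrow> real) \<Rightarrow> real \<Rightarrow> real" where
  "momentum u0 = (\<lambda>x. u0 x - deriv (deriv u0) x)"

definition DP_solitary_profile :: "real \<Rightarrow> real \<Rightarrow> (real \<Rightarrow> real) \<Rightarrow> bool" where
  "DP_solitary_profile k c u0 \<longleftrightarrow>
     smooth_line u0 \<and>
     DP_solution (\<lambda>x t. u0 (x - c * t)) \<and>
     \<not> u0 constant_on UNIV \<and>
     (\<forall>x. u0 (- x) = u0 x) \<and>
     (\<forall>x. (c - u0 x) ^ 3 * (u0 x - deriv (deriv u0) x) = k * (c - k) ^ 3) \<and>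
     deriv u0 0 = 0 \<and>
     (u0 \<longlongrightarrow> k) at_infinity \<and>
     (\<forall>x. 0 < u0 x \<and> u0 x < c) \<and>
     (\<forall>x. u0 x - deriv (deriv u0) x > 0)"

definition Lax_pair ::
  "complex \<Rightarrow> real \<Rightarrow> (real \<Rightarrow> real) \<Rightarrow> (real \<Rightarrow> real \<Rightarrow> complex) \<Rightarrow> bool" where
  "Lax_pair \<sigma> c u0 \<phi> \<longleftrightarrow>
     (\<forall>x t. ds (ds (ds \<phi>)) x t = ds \<phi> x t + \<sigma> * of_real (momentum u0 x) * \<phi> x t) \<and>
     (\<forall>x t. dt \<phi> x t = 1 / \<sigma> * ds (ds \<phi>) x t
              + of_real (c - u0 x) * ds \<phi> x t + of_real (deriv u0 x) * \<phi> x t)"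

definition adjoint_Lax_pair ::
  "complex \<Rightarrow> real \<Rightarrow> (real \<Rightarrow> real) \<Rightarrow> (real \<Rightarrow> real \<Rightarrow> complex) \<Rightarrow> bool" where
  "adjoint_Lax_pair \<sigma> c u0 \<psi> \<longleftrightarrow>
     (\<forall>x t. ds (ds (ds \<psi>)) x t = ds \<psi> x t - \<sigma> * of_real (momentum u0 x) * \<psi> x t) \<and>
     (\<forall>x t. dt \<psi> x t = - (1 / \<sigma>) * ds (ds \<psi>) x t
              + of_real (c - u0 x) * ds \<psi> x t + of_real (deriv u0 x) * \<psi> x t)"

text \<open>
  Linearization of the equation about \<open>u0\<close> in the moving coordinate \<open>\<xi> = x - c t\<close>. Smoothness is
  part of being a solution, so that none of the derivatives is a junk value.
\<close>

definition linearized_DP_solution ::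
  "real \<Rightarrow> (real \<Rightarrow> real) \<Rightarrow> (real \<Rightarrow> real \<Rightarrow> complex) \<Rightarrow> bool" where
  "linearized_DP_solution c u0 v \<longleftrightarrow> smooth_plane v \<and>
     (\<forall>x t. dt v x t - ds (ds (dt v)) x t =
          of_real c * ds (\<lambda>y s. v y s - ds (ds v) y s) x t
        + 3 * of_real (deriv u0 x) * ds (ds v) x t
        + 3 * of_real (deriv (deriv u0) x) * ds v x t
        - 4 * of_real (u0 x) * ds v x t
        - 4 * of_real (deriv u0 x) * v x t
        + of_real (u0 x) * ds (ds (ds v)) x t
        + of_real (deriv (deriv (deriv u0)) x) * v x t)"

end

theory Submission
  imports Defs
begin

text \<open>
  With \<open>w = \<phi>\<psi> - \<phi>\<^sub>\<xi>\<psi>\<^sub>\<xi>\<close>, equality of mixed partials gives \<open>v\<^sub>t = (w\<^sub>t)\<^sub>\<xi>\<close>. The Lax pairs eliminate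
  all time derivatives and all third space derivatives of \<open>\<phi>\<close> and \<open>\<psi>\<close>, so both sides of the
  linearized equation become bilinear in the 2-jets of \<open>\<phi>\<close> and \<open>\<psi>\<close>, with coefficients polynomial in
  \<open>1/\<sigma>\<close>, \<open>\<sigma>m\<close>, \<open>u\<^sub>0\<close> and their derivatives, and they agree coefficient by coefficient.
\<close>

subsection \<open>Partial derivatives of smooth functions on the plane\<close>

lemma smooth_plane_ds: "smooth_plane f \<Longrightarrow> smooth_plane (ds f)"
  unfolding smooth_plane_def by (metis Cn_plane.simps(2))

lemma smooth_plane_dt: "smooth_plane f \<Longrightarrow> smooth_plane (dt f)"
  unfolding smooth_plane_def by (metis Cn_plane.simps(2))

lemma ds_eqI:
  assumes "\<And>x t. ((\<lambda>y. f y t) has_vector_derivative f' x t) (at x)"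
  shows "ds f = f'"
  unfolding ds_def by (intro ext vector_derivative_at assms)

lemma dt_eqI:
  assumes "\<And>x t. ((\<lambda>s. f x s) has_vector_derivative f' x t) (at t)"
  shows "dt f = f'"
  unfolding dt_def by (intro ext vector_derivative_at assms)

text \<open>Induction step for the closure proofs: any explicit formulas for the two partials are
  accepted, so sum and product rules can be fed in directly.\<close>

lemma Cn_plane_SucI:
  assumes "\<And>x t. ((\<lambda>y. f y t) has_vector_derivative fx x t) (at x)"
    and "\<And>x t. ((\<lambda>s. f x s) has_vector_derivative ft x t) (at t)"
    and "continuous_on UNIV (\<lambda>(x, t). f x t)"
    and "Cn_plane n fx" and "Cn_plane n ft"
  shows "Cn_plane (Suc n) f"
  using assms(3-5) differentiableI_vector[OF assms(1)] differentiableI_vector[OF assms(2)]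
  by (simp add: ds_eqI[of f fx, OF assms(1)] dt_eqI[of f ft, OF assms(2)])

lemma Cn_plane_Suc_derivs:
  assumes "Cn_plane (Suc n) f"
  shows "((\<lambda>y. f y t) has_vector_derivative ds f x t) (at x)"
    and "((\<lambda>s. f x s) has_vector_derivative dt f x t) (at t)"
  using assms by (simp_all add: ds_def dt_def vector_derivative_works)

lemma Cn_plane_continuous: "Cn_plane n f \<Longrightarrow> continuous_on UNIV (\<lambda>(x, t). f x t)"
  by (cases n) auto

lemma smooth_plane_continuous: "smooth_plane f \<Longrightarrow> continuous_on UNIV (\<lambda>(x, t). f x t)"
  unfolding smooth_plane_def using Cn_plane_continuous by blast

lemma smooth_plane_has_ds:
  "smooth_plane f \<Longrightarrow> ((\<lambda>y. f y t) has_vector_derivative ds f x t) (at x)"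
  unfolding smooth_plane_def using Cn_plane_Suc_derivs(1) by blast

lemma smooth_plane_has_dt:
  "smooth_plane f \<Longrightarrow> ((\<lambda>s. f x s) has_vector_derivative dt f x t) (at t)"
  unfolding smooth_plane_def using Cn_plane_Suc_derivs(2) by blast

text \<open>The order is lowered on \<open>ds f\<close> and \<open>dt f\<close> by induction, since
  the recursion constrains a function beyond first order only through these two.\<close>

lemma Cn_plane_SucD: "Cn_plane (Suc n) f \<Longrightarrow> Cn_plane n f"
proof (induction n arbitrary: f)
  case 0
  then show ?case
    by simp
next
  case (Suc n)
  from Suc.prems Suc.IH[of "ds f"] Suc.IH[of "dt f"] show ?case
    unfolding Cn_plane.simps(2)[of "Suc n" f] Cn_plane.simps(2)[of n f] by blast
qed

section \<open>Closure of the classes C^n under algebraic operations\<close>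

lemma Cn_plane_add:
  assumes "Cn_plane n f" and "Cn_plane n g"
  shows "Cn_plane n (\<lambda>x t. f x t + g x t)"
  using assms
proof (induction n arbitrary: f g)
  case 0
  then show ?case
    by (auto simp: split_beta intro: continuous_intros)
next
  case (Suc n)
  have "continuous_on UNIV (\<lambda>(x, t). f x t + g x t)"
    using Suc.prems[THEN Cn_plane_continuous] by (auto simp: split_beta intro: continuous_intros)
  then show ?case
    using Suc
    by (intro Cn_plane_SucI[OF has_vector_derivative_add[OF Cn_plane_Suc_derivs(1) Cn_plane_Suc_derivs(1)]
          has_vector_derivative_add[OF Cn_plane_Suc_derivs(2) Cn_plane_Suc_derivs(2)]]) auto
qed

lemma Cn_plane_uminus:
  assumes "Cn_plane n f"
  shows "Cn_plane n (\<lambda>x t. - f x t)"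
  using assms
proof (induction n arbitrary: f)
  case 0
  then show ?case
    by (auto simp: split_beta intro: continuous_intros)
next
  case (Suc n)
  have "continuous_on UNIV (\<lambda>(x, t). - f x t)"
    using Suc.prems[THEN Cn_plane_continuous] by (auto simp: split_beta intro: continuous_intros)
  then show ?case
    using Suc
    by (intro Cn_plane_SucI[OF has_vector_derivative_minus[OF Cn_plane_Suc_derivs(1)]
          has_vector_derivative_minus[OF Cn_plane_Suc_derivs(2)]]) auto
qed

lemma Cn_plane_mult:
  fixes f g :: "real \<Rightarrow> real \<Rightarrow> 'a::real_normed_algebra"
  assumes "Cn_plane n f" and "Cn_plane n g"
  shows "Cn_plane n (\<lambda>x t. f x t * g x t)"
  using assms
proof (induction n arbitrary: f g)
  case 0
  then show ?case
    by (auto simp: split_beta intro: continuous_intros)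
next
  case (Suc n)
  have "continuous_on UNIV (\<lambda>(x, t). f x t * g x t)"
    using Suc.prems[THEN Cn_plane_continuous] by (auto simp: split_beta intro: continuous_intros)
  \<comment> \<open>The product rule leaves one factor undifferentiated, and that factor must also
    be of class \<open>n\<close> for the induction hypothesis to apply.\<close>
  moreover have "Cn_plane n f" "Cn_plane n g"
    using Suc.prems by (blast intro: Cn_plane_SucD)+
  ultimately show ?case
    using Suc
    by (intro Cn_plane_SucI[OF has_vector_derivative_mult[OF Cn_plane_Suc_derivs(1) Cn_plane_Suc_derivs(1)]
          has_vector_derivative_mult[OF Cn_plane_Suc_derivs(2) Cn_plane_Suc_derivs(2)]] Cn_plane_add) auto
qed

lemma smooth_plane_mult:
  fixes f g :: "real \<Rightarrow> real \<Rightarrow> 'a::real_normed_algebra"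
  shows "smooth_plane f \<Longrightarrow> smooth_plane g \<Longrightarrow> smooth_plane (\<lambda>x t. f x t * g x t)"
  unfolding smooth_plane_def using Cn_plane_mult by blast

lemma smooth_plane_diff:
  "smooth_plane f \<Longrightarrow> smooth_plane g \<Longrightarrow> smooth_plane (\<lambda>x t. f x t - g x t)"
  unfolding smooth_plane_def using Cn_plane_add[OF _ Cn_plane_uminus, of _ f g] by simp

text \<open>Write \<open>f\<close> as its value at an earlier time plus the time integral of
  \<open>dt f\<close>, differentiate under the integral sign in space, then apply the fundamental
  theorem of calculus in time.\<close>

lemma dt_ds_commute:
  fixes f :: "real \<Rightarrow> real \<Rightarrow> 'a::banach"
  assumes f: "smooth_plane f"
  shows "dt (ds f) = ds (dt f)"
proof (rule dt_eqI)
  fix x t :: real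
  \<comment> \<open>Integrals start at \<open>t - 1\<close>, and \<open>t\<close> is interior to
    \<open>?I\<close>, so the derivative within \<open>?I\<close> found at the end is a two-sided
    one.\<close>
  let ?I = "{t - 1..t + 1}"
  have cont: "continuous_on A (g x)" if "smooth_plane g" for A x and g :: "real \<Rightarrow> real \<Rightarrow> 'a"
    using continuous_on_compose2[OF smooth_plane_continuous[OF that], of A "Pair x"]
    by (simp add: continuous_on_Pair continuous_on_const continuous_on_id)
  have FTC: "f y s = f y (t - 1) + integral {t - 1..s} (dt f y)" if "s \<in> ?I" for y s
  proof -
    have "(dt f y has_integral f y s - f y (t - 1)) {t - 1..s}"
      using that
      by (intro fundamental_theorem_of_calculus
          has_vector_derivative_at_within[OF smooth_plane_has_dt[OF f]]) auto
    then show ?thesis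
      by (simp add: integral_unique)
  qed
  \<comment> \<open>The Leibniz rule applies because \<open>ds (dt f)\<close> is jointly
    continuous.\<close>
  have *: "ds f x s = ds f x (t - 1) + integral {t - 1..s} (ds (dt f) x)" if "s \<in> ?I" for s
  proof -
    have "((\<lambda>y. integral (cbox (t - 1) s) (dt f y)) has_vector_derivative
        integral (cbox (t - 1) s) (ds (dt f) x)) (at x within UNIV)"
    proof (rule leibniz_rule_vector_derivative)
      show "continuous_on (UNIV \<times> cbox (t - 1) s) (\<lambda>(x, t). ds (dt f) x t)"
        using smooth_plane_continuous[OF smooth_plane_ds[OF smooth_plane_dt[OF f]]]
        by (rule continuous_on_subset) simp
    qed (auto intro: integrable_continuous_real cont smooth_plane_dt[OF f]
        smooth_plane_has_ds[OF smooth_plane_dt[OF f]])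
    from has_vector_derivative_add[OF smooth_plane_has_ds[OF f, of "t - 1" x] this[unfolded box_real]]
    have "((\<lambda>y. f y s) has_vector_derivative
        ds f x (t - 1) + integral {t - 1..s} (ds (dt f) x)) (at x)"
      by (simp add: FTC[OF that, symmetric])
    from vector_derivative_at[OF this] show ?thesis
      by (simp add: ds_def)
  qed
  have "((\<lambda>s. ds f x (t - 1) + integral {t - 1..s} (ds (dt f) x)) has_vector_derivative
      0 + ds (dt f) x t) (at t within ?I)"
    by (rule has_vector_derivative_add[OF has_vector_derivative_const
          integral_has_vector_derivative[OF cont[OF smooth_plane_ds[OF smooth_plane_dt[OF f]]]]]) simp
  then have "((\<lambda>s. ds f x s) has_vector_derivative ds (dt f) x t) (at t within ?I)"
    unfolding add_0 by (rule has_vector_derivative_transform[OF _ *, rotated 2]) simp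
  then show "((\<lambda>s. ds f x s) has_vector_derivative ds (dt f) x t) (at t)"
    by (simp add: at_within_Icc_at)
qed

subsection \<open>The squared eigenfunction\<close>

theorem lemma4p6:
  fixes c k :: real and u0 :: "real \<Rightarrow> real" and \<sigma> :: complex
    and \<phi> \<psi> :: "real \<Rightarrow> real \<Rightarrow> complex"
  assumes "c > 0" and "0 < k" and "k < c / 4"
    and "DP_solitary_profile k c u0"
    and "\<sigma> \<noteq> 0"
    and "smooth_plane \<phi>" and "smooth_plane \<psi>"
    and "Lax_pair \<sigma> c u0 \<phi>"
    and "adjoint_Lax_pair \<sigma> c u0 \<psi>"
  shows "linearized_DP_solution c u0
           (ds (\<lambda>\<xi> t. \<phi> \<xi> t * \<psi> \<xi> t - ds \<phi> \<xi> t * ds \<psi> \<xi> t))"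
proof -
  let ?w = "\<lambda>x t. \<phi> x t * \<psi> x t - ds \<phi> x t * ds \<psi> x t"
  define f1 f2 g1 g2 where "f1 = ds \<phi>" and "f2 = ds f1" and "g1 = ds \<psi>" and "g2 = ds g1"
  define r where "r = 1 / \<sigma>"
  \<comment> \<open>Writing \<open>m = r N\<close> makes the identities below polynomial, with no use of \<open>r \<sigma> = 1\<close>.\<close>
  define U P N N1 N2 :: "real \<Rightarrow> complex"
    where "U = (\<lambda>x. of_real (u0 x))" and "P = (\<lambda>x. of_real (deriv u0 x))"
      and "N = (\<lambda>x. \<sigma> * of_real (momentum u0 x))"
      and "N1 = (\<lambda>x. \<sigma> * of_real (deriv u0 x - (deriv ^^ 3) u0 x))"
      and "N2 = (\<lambda>x. \<sigma> * of_real ((deriv ^^ 2) u0 x - (deriv ^^ 4) u0 x))"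

  \<comment> \<open>Differentiation rules for coefficients and jets\<close>
  have u0: "((deriv ^^ n) u0 has_real_derivative (deriv ^^ Suc n) u0 x) (at x)" for n x
    using \<open>DP_solitary_profile k c u0\<close>
    by (simp add: DP_solitary_profile_def smooth_line_def DERIV_deriv_iff_real_differentiable)
  \<comment> \<open>Since \<open>u0'' = u0 - m\<close> and \<open>m = r N\<close>, the higher
    derivatives of the profile are traded for \<open>U\<close>, \<open>P\<close>, \<open>N\<close>,
    \<open>N1\<close>. Only here does \<open>r * \<sigma> = 1\<close> enter.\<close>
  have u_eqs: "of_real (deriv (deriv u0) x) = U x - r * N x"
    "of_real (deriv (deriv (deriv u0)) x) = P x - r * N1 x" for x
    using \<open>\<sigma> \<noteq> 0\<close> by (simp_all add: U_def P_def N_def N1_def r_def momentum_def numeral_eq_Suc)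
  have dU: "(U has_vector_derivative P x) (at x)" for x
    unfolding U_def P_def using u0[of 0 x] by (intro has_vector_derivative_of_real) simp
  have dP: "(P has_vector_derivative U x - r * N x) (at x)" for x
    unfolding P_def u_eqs[symmetric]
    using u0[of 1 x] by (intro has_vector_derivative_of_real) simp
  have dN: "(N has_vector_derivative N1 x) (at x)" for x
    unfolding N_def N1_def momentum_def
    using DERIV_diff[OF u0[of 0 x] u0[of 2 x]]
    by (intro has_vector_derivative_mult_right has_vector_derivative_of_real)
      (simp add: numeral_eq_Suc)
  have dN1: "(N1 has_vector_derivative N2 x) (at x)" for x
    unfolding N1_def N2_def
    using DERIV_diff[OF u0[of 1 x] u0[of 3 x]]
    by (intro has_vector_derivative_mult_right has_vector_derivative_of_real)
      (simp add: numeral_eq_Suc)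
  have sm: "smooth_plane f1" "smooth_plane f2" "smooth_plane g1" "smooth_plane g2"
    by (simp_all add: f1_def f2_def g1_def g2_def smooth_plane_ds assms)
  have f3: "ds f2 = (\<lambda>x t. f1 x t + N x * \<phi> x t)"
    using \<open>Lax_pair \<sigma> c u0 \<phi>\<close> by (auto simp: Lax_pair_def f1_def f2_def N_def)
  have g3: "ds g2 = (\<lambda>x t. g1 x t - N x * \<psi> x t)"
    using \<open>adjoint_Lax_pair \<sigma> c u0 \<psi>\<close> by (auto simp: adjoint_Lax_pair_def g1_def g2_def N_def)
  \<comment> \<open>With third derivatives eliminated, these rules keep all space derivatives
    polynomial in the jets and coefficients. \<open>N2\<close> occurs only in \<open>v3\<close>,
    which is never differentiated, so \<open>dN1\<close> is the last rule.\<close>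
  note jets = smooth_plane_has_ds[OF \<open>smooth_plane \<phi>\<close>, folded f1_def]
    smooth_plane_has_ds[OF \<open>smooth_plane \<psi>\<close>, folded g1_def]
    sm(1)[THEN smooth_plane_has_ds, folded f2_def]
    sm(3)[THEN smooth_plane_has_ds, folded g2_def]
    sm(2)[THEN smooth_plane_has_ds, unfolded f3]
    sm(4)[THEN smooth_plane_has_ds, unfolded g3] dU dP dN dN1

  \<comment> \<open>Time derivatives of the eigenfunctions\<close>
  have dtf: "dt \<phi> = (\<lambda>x t. r * f2 x t + (of_real c - U x) * f1 x t + P x * \<phi> x t)"
    using \<open>Lax_pair \<sigma> c u0 \<phi>\<close> by (intro ext) (simp add: Lax_pair_def f1_def f2_def U_def P_def r_def)
  have dtg: "dt \<psi> = (\<lambda>x t. - r * g2 x t + (of_real c - U x) * g1 x t + P x * \<psi> x t)"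
    using \<open>adjoint_Lax_pair \<sigma> c u0 \<psi>\<close>
    by (intro ext) (simp add: adjoint_Lax_pair_def g1_def g2_def U_def P_def r_def)
  \<comment> \<open>The term \<open>r * N * \<phi>\<close> from \<open>f3\<close> cancels against
    the one from \<open>dP\<close>, and the two terms \<open>P * f1\<close> cancel.\<close>
  have dtf1: "dt f1 = (\<lambda>x t. r * f1 x t + (of_real c - U x) * f2 x t + U x * \<phi> x t)"
    unfolding f1_def dt_ds_commute[OF \<open>smooth_plane \<phi>\<close>] unfolding dtf f1_def[symmetric]
    by (rule ds_eqI) (auto intro!: derivative_eq_intros jets simp: algebra_simps)
  have dtg1: "dt g1 = (\<lambda>x t. - r * g1 x t + (of_real c - U x) * g2 x t + U x * \<psi> x t)"
    unfolding g1_def dt_ds_commute[OF \<open>smooth_plane \<psi>\<close>] unfolding dtg g1_def[symmetric]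
    by (rule ds_eqI) (auto intro!: derivative_eq_intros jets simp: algebra_simps)

  \<comment> \<open>Space derivatives of the squared eigenfunction\<close>
  define v where "v = (\<lambda>x t. f1 x t * \<psi> x t + \<phi> x t * g1 x t - f2 x t * g1 x t - f1 x t * g2 x t)"
  define v1 where "v1 = (\<lambda>x t. f2 x t * \<psi> x t + \<phi> x t * g2 x t - 2 * f2 x t * g2 x t
    + N x * (f1 x t * \<psi> x t - \<phi> x t * g1 x t))"
  \<comment> \<open>Splitting off \<open>v\<close> shows that \<open>v - v2\<close> involves only
    terms carrying a factor \<open>N\<close> or \<open>N1\<close>.\<close>
  define v2 where "v2 = (\<lambda>x t. v x t + N1 x * (f1 x t * \<psi> x t - \<phi> x t * g1 x t)
    + 3 * N x * (f2 x t * \<psi> x t - \<phi> x t * g2 x t))"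
  define v3 where "v3 = (\<lambda>x t. v1 x t + N2 x * (f1 x t * \<psi> x t - \<phi> x t * g1 x t)
    + 4 * N1 x * (f2 x t * \<psi> x t - \<phi> x t * g2 x t)
    + 3 * N x * (f2 x t * g1 x t - f1 x t * g2 x t + f1 x t * \<psi> x t - \<phi> x t * g1 x t)
    + 6 * (N x)\<^sup>2 * \<phi> x t * \<psi> x t)"
  have dsw: "ds ?w = v"
    unfolding f1_def[symmetric] g1_def[symmetric] v_def
    by (rule ds_eqI) (auto intro!: derivative_eq_intros jets)
  have dv: "((\<lambda>y. v y t) has_vector_derivative v1 x t) (at x)" for x t
    unfolding v_def v1_def by (auto intro!: derivative_eq_intros jets simp: algebra_simps)
  have dv1: "((\<lambda>y. v1 y t) has_vector_derivative v2 x t) (at x)" for x t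
    unfolding v1_def v2_def v_def by (auto intro!: derivative_eq_intros jets simp: algebra_simps)
  have dv2: "((\<lambda>y. v2 y t) has_vector_derivative v3 x t) (at x)" for x t
    unfolding v2_def v3_def
    by (auto intro!: derivative_eq_intros jets dv simp: algebra_simps power2_eq_square)
  have ds_v: "ds v = v1" "ds v1 = v2" "ds v2 = v3"
    by (rule ds_eqI dv dv1 dv2)+
  have ds_v_v2: "ds (\<lambda>y s. v y s - v2 y s) = (\<lambda>x t. v1 x t - v3 x t)"
    by (rule ds_eqI) (intro has_vector_derivative_diff dv dv2)

  \<comment> \<open>Time derivative and the linearized equation\<close>
  have smw: "smooth_plane ?w"
    by (intro smooth_plane_diff smooth_plane_mult smooth_plane_ds assms)
  \<comment> \<open>The transport terms with factor \<open>c - U\<close> reassemble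
    \<open>v\<close>; the terms \<open>r * f1 * g1\<close> cancel because \<open>r\<close> has
    opposite signs in the two Lax pairs.\<close>
  have dtw: "dt ?w = (\<lambda>x t. (of_real c - U x) * v x t + r * (f2 x t * \<psi> x t - \<phi> x t * g2 x t)
      + 2 * P x * \<phi> x t * \<psi> x t - U x * (f1 x t * \<psi> x t + \<phi> x t * g1 x t))"
    unfolding f1_def[symmetric] g1_def[symmetric]
    by (rule dt_eqI, rule has_vector_derivative_eq_rhs,
        rule has_vector_derivative_diff[OF
          has_vector_derivative_mult[OF \<open>smooth_plane \<phi>\<close>[THEN smooth_plane_has_dt]
            \<open>smooth_plane \<psi>\<close>[THEN smooth_plane_has_dt]]
          has_vector_derivative_mult[OF sm(1,3)[THEN smooth_plane_has_dt]]])
      (simp add: dtf dtg dtf1 dtg1 v_def algebra_simps)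
  \<comment> \<open>Passing through \<open>ds (dt ?w)\<close> avoids time derivatives of
    \<open>f2\<close> and \<open>g2\<close>. The two contributions
    \<open>2 * r * N * \<phi> * \<psi>\<close>, from \<open>f3\<close>, \<open>g3\<close> and from
    \<open>dP\<close>, cancel.\<close>
  have dt_v: "dt v = (\<lambda>x t. (of_real c - U x) * v1 x t
      + r * (f1 x t * \<psi> x t - \<phi> x t * g1 x t + f2 x t * g1 x t - f1 x t * g2 x t)
      + U x * (2 * \<phi> x t * \<psi> x t - \<phi> x t * g2 x t - f2 x t * \<psi> x t - 2 * f1 x t * g1 x t)
      + P x * (f1 x t * g2 x t + f2 x t * g1 x t))"
    unfolding dsw[symmetric] dt_ds_commute[OF smw] unfolding dtw
    by (rule ds_eqI) (auto intro!: derivative_eq_intros jets dv simp: v_def v1_def algebra_simps)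
  have ds_dt_v: "ds (dt v) = (\<lambda>x t. (of_real c - U x) * v2 x t
      + r * (f2 x t * \<psi> x t - \<phi> x t * g2 x t) + r * N x * v x t
      + U x * (\<phi> x t * g1 x t + f1 x t * \<psi> x t - 2 * f1 x t * g2 x t - 2 * f2 x t * g1 x t)
      + 2 * P x * (\<phi> x t * \<psi> x t - v1 x t))"
    unfolding dt_v
    by (rule ds_eqI) (auto intro!: derivative_eq_intros jets dv dv1
        simp: v_def v1_def v2_def algebra_simps)
  have ds_ds_dt_v: "ds (ds (dt v)) = (\<lambda>x t. (of_real c - U x) * v3 x t - P x * v2 x t
      + r * (f1 x t * \<psi> x t - \<phi> x t * g1 x t + f2 x t * g1 x t - f1 x t * g2 x t)
      + 2 * r * N x * \<phi> x t * \<psi> x t + r * N1 x * v x t + r * N x * v1 x t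
      + P x * (\<phi> x t * g1 x t + f1 x t * \<psi> x t - 2 * f1 x t * g2 x t - 2 * f2 x t * g1 x t)
      + U x * (\<phi> x t * g2 x t + f2 x t * \<psi> x t - 2 * f1 x t * g1 x t - 4 * f2 x t * g2 x t
          + 2 * N x * (f1 x t * \<psi> x t - \<phi> x t * g1 x t))
      + 2 * (U x - r * N x) * (\<phi> x t * \<psi> x t - v1 x t)
      + 2 * P x * (\<phi> x t * g1 x t + f1 x t * \<psi> x t - v2 x t))"
    unfolding ds_dt_v
    by (rule ds_eqI) (auto intro!: derivative_eq_intros jets dv dv1 dv2 simp: algebra_simps)
  \<comment> \<open>\<open>v2\<close> and \<open>v3\<close> have matching coefficients
    \<open>3 * P\<close> and \<open>U - c\<close> on both sides and stay folded; expanding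
    \<open>v\<close> and \<open>v1\<close> settles the rest.\<close>
  have "dt v x t - ds (ds (dt v)) x t =
      of_real c * (v1 x t - v3 x t) + 3 * P x * v2 x t + 3 * (U x - r * N x) * v1 x t
      - 4 * U x * v1 x t - 4 * P x * v x t + U x * v3 x t + (P x - r * N1 x) * v x t" for x t
    unfolding ds_ds_dt_v unfolding dt_v
    by (simp add: v_def v1_def algebra_simps)
  moreover have "smooth_plane v"
    unfolding dsw[symmetric] by (rule smooth_plane_ds[OF smw])
  ultimately show ?thesis
    unfolding dsw linearized_DP_solution_def u_eqs ds_v ds_v_v2
    by (simp add: U_def P_def)
qed

end
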